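(* Let $S$ be a finite nonempty set, let $p:2^S\to\mathbb{Z}\cup\{-\infty\}$ be a supermodular function with $p(\emptyset)=0$ and $p(S)$ finite, and let $B=\{x\in\mathbb{R}^S:\ \widetilde x(S)=p(S),\ \widetilde x(Z)\ge p(Z)\ \text{for all } Z\subset S\}$ be the (nonempty, integral) base-polyhedron it defines, with $\dot B=B\cap\mathbb{Z}^S$. Then for each integer $a$, $$\min\Big\{\sum_{s\in S}(m(s)-a)^+ : m\in\dot B\Big\}=\max\{p(X)-a|X| : X\subseteq S\},$$ where $(z)^+=\max\{0,z\}$. Moreover, an element of $\dot B$ is a decreasingly minimal element of $\dot B$ if and only if it is a minimizer of the left-hand side for every $a\in\mathbb{Z}$.
   Context: For $x\in\mathbb{R}^S$ and $X\subseteq S$, $\widetilde x(X)=\sum_{v\in X}x(v)$. The function $p$ is supermodular if $p(X)+p(Y)\le p(X\cap Y)+p(X\cup Y)$ whenever $p(X),p(Y)$ are finite. For a vector $x$, $x{\downarrow}$ is the vector obtained by rearranging the components of $x$ in decreasing order. A vector $x$ is decreasingly smaller than $y$ if $x{\downarrow}\ne y{\downarrow}$ and $x{\downarrow}(j)<y{\downarrow}(j)$ for the smallest index $j$ where they differ; $x\le_{\rm dec}y$ means $x$ is decreasingly smaller than $y$ or $x{\downarrow}=y{\downarrow}$. An element $m$ of a set $Q$ is decreasingly minimal (dec-min) in $Q$ if $m\le_{\rm dec}y$ for all $y\in Q$. *)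

theory Defs
  imports Complex_Main "HOL-Library.FuncSet" "HOL-Library.Multiset" "HOL-Library.Extended_Real"
begin

text \<open>
  A vector in $\mathbb{R}^S$ is an extensional function in \<open>S \<rightarrow>\<^sub>E UNIV\<close>, so that vectors
  are determined by their components in \<open>S\<close>.  A set function with values in
  $\mathbb{Z}\cup\{-\infty\}$ is a function into \<^typ>\<open>ereal\<close> of which only the values on subsets
  of \<open>S\<close> matter.
\<close>

definition int_or_minf_valued :: "'a set \<Rightarrow> ('a set \<Rightarrow> ereal) \<Rightarrow> bool" where
  "int_or_minf_valued S p \<longleftrightarrow> (\<forall>X\<subseteq>S. p X = -\<infinity> \<or> (\<exists>k::int. p X = ereal (of_int k)))"

definition supermodular_on :: "'a set \<Rightarrow> ('a set \<Rightarrow> ereal) \<Rightarrow> bool" where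
  "supermodular_on S p \<longleftrightarrow>
     (\<forall>X Y. X \<subseteq> S \<longrightarrow> Y \<subseteq> S \<longrightarrow> \<bar>p X\<bar> \<noteq> \<infinity> \<longrightarrow> \<bar>p Y\<bar> \<noteq> \<infinity> \<longrightarrow>
        p X + p Y \<le> p (X \<inter> Y) + p (X \<union> Y))"

definition base_polyhedron :: "'a set \<Rightarrow> ('a set \<Rightarrow> ereal) \<Rightarrow> ('a \<Rightarrow> real) set" where
  "base_polyhedron S p =
     {x \<in> S \<rightarrow>\<^sub>E UNIV. ereal (\<Sum>v\<in>S. x v) = p S \<and> (\<forall>Z. Z \<subset> S \<longrightarrow> p Z \<le> ereal (\<Sum>v\<in>Z. x v))}"

definition integral_base_points :: "'a set \<Rightarrow> ('a set \<Rightarrow> ereal) \<Rightarrow> ('a \<Rightarrow> real) set" where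
  "integral_base_points S p = {x \<in> base_polyhedron S p. \<forall>s\<in>S. x s \<in> \<int>}"

text \<open>The components $x(s)$, $s \in S$, with multiplicity, in decreasing order.\<close>

definition dec_sorted :: "'a set \<Rightarrow> ('a \<Rightarrow> real) \<Rightarrow> real list" where
  "dec_sorted S x = rev (sorted_list_of_multiset (image_mset x (mset_set S)))"

definition dec_smaller :: "'a set \<Rightarrow> ('a \<Rightarrow> real) \<Rightarrow> ('a \<Rightarrow> real) \<Rightarrow> bool" where
  "dec_smaller S x y \<longleftrightarrow>
     (\<exists>j < card S. (\<forall>i < j. dec_sorted S x ! i = dec_sorted S y ! i) \<and>
                   dec_sorted S x ! j < dec_sorted S y ! j)"

definition dec_le :: "'a set \<Rightarrow> ('a \<Rightarrow> real) \<Rightarrow> ('a \<Rightarrow> real) \<Rightarrow> bool" where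
  "dec_le S x y \<longleftrightarrow> dec_smaller S x y \<or> dec_sorted S x = dec_sorted S y"

definition dec_min :: "'a set \<Rightarrow> ('a \<Rightarrow> real) set \<Rightarrow> ('a \<Rightarrow> real) \<Rightarrow> bool" where
  "dec_min S Q m \<longleftrightarrow> m \<in> Q \<and> (\<forall>y\<in>Q. dec_le S m y)"

definition total_excess :: "'a set \<Rightarrow> int \<Rightarrow> ('a \<Rightarrow> real) \<Rightarrow> real" where
  "total_excess S a m = (\<Sum>s\<in>S. max 0 (m s - of_int a))"

end

(* An integral base point m minimizing the sum of squares admits no unit transfer from t to s
   inside the base polyhedron when m t >= m s + 2.  For given a, every such transfer from
   {m > a} to {m < a} is therefore blocked by a tight set containing t but not s; uncrossing these
   sets yields a tight X with {m > a} <= X <= {m >= a}, so that the total excess of m over a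
   equals p X - a |X|, which is a lower bound for every base point.  This single m works for all a.
   Since the total excesses for all a determine the sorted vector and detect the first index
   where two sorted vectors differ, simultaneous minimizers are exactly the dec-min elements. *)

theory Submission
  imports Defs
begin

section \<open>Sorted vectors and total excess\<close>

lemma mset_dec_sorted [simp]: "mset (dec_sorted S x) = image_mset x (mset_set S)"
  by (simp add: dec_sorted_def)

lemma length_dec_sorted [simp]: "length (dec_sorted S x) = card S"
  by (metis mset_dec_sorted size_image_mset size_mset size_mset_set)

lemma set_dec_sorted: "finite S \<Longrightarrow> set (dec_sorted S x) = x ` S"
  by (metis finite_set_mset_mset_set mset_dec_sorted set_image_mset set_mset_mset)

lemma dec_sorted_antimono:
  assumes "i \<le> j" "j < card S"
  shows "dec_sorted S x ! j \<le> dec_sorted S x ! i"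
proof -
  have "sorted (rev (dec_sorted S x))"
    by (simp add: dec_sorted_def)
  then show ?thesis
    using assms sorted_rev_nth_mono[of "dec_sorted S x" i j] by simp
qed

text \<open>The excess is symmetric in the components, so it depends only on their multiset; in this
  form two vectors can be compared index by index.\<close>

lemma total_excess_dec_sorted:
  "total_excess S a x = (\<Sum>i<card S. max 0 (dec_sorted S x ! i - of_int a))"
proof -
  have "total_excess S a x = sum_mset (image_mset (\<lambda>v. max 0 (v - of_int a)) (image_mset x (mset_set S)))"
    by (simp add: total_excess_def sum_unfold_sum_mset multiset.map_comp comp_def)
  also have "\<dots> = sum_mset (image_mset (\<lambda>v. max 0 (v - of_int a)) (mset (dec_sorted S x)))"
    by simp
  also have "\<dots> = sum_list (map (\<lambda>v. max 0 (v - of_int a)) (dec_sorted S x))"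
    by (metis mset_map sum_mset_sum_list)
  also have "\<dots> = (\<Sum>i<card S. max 0 (dec_sorted S x ! i - of_int a))"
    by (simp add: sum_list_sum_nth atLeast0LessThan)
  finally show ?thesis .
qed

lemma dec_smaller_asym: "dec_smaller S x y \<Longrightarrow> \<not> dec_smaller S y x"
  unfolding dec_smaller_def by (metis linorder_less_linear order_less_asym order_less_irrefl)

lemma not_dec_le_imp_dec_smaller:
  assumes "\<not> dec_le S x y"
  shows "dec_smaller S y x"
proof -
  let ?P = "\<lambda>i. i < card S \<and> dec_sorted S x ! i \<noteq> dec_sorted S y ! i"
  have "dec_sorted S x \<noteq> dec_sorted S y" and ns: "\<not> dec_smaller S x y"
    using assms by (auto simp: dec_le_def)
  then have "\<exists>i. ?P i"
    by (metis length_dec_sorted nth_equalityI)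
  then obtain j where "?P j" and "\<forall>i<j. \<not> ?P i"
    using exists_least_iff[of ?P] by blast
  then have j: "j < card S" "dec_sorted S x ! j \<noteq> dec_sorted S y ! j"
    "\<forall>i<j. dec_sorted S x ! i = dec_sorted S y ! i"
    by auto
  then have "\<not> dec_sorted S x ! j < dec_sorted S y ! j"
    using ns unfolding dec_smaller_def by blast
  then show ?thesis
    using j unfolding dec_smaller_def by (intro exI[of _ j]) auto
qed

text \<open>The witness \<open>a\<close> is the entry of the smaller vector at the first index of difference: there
  the later entries of that vector contribute no excess.\<close>

lemma dec_smaller_imp_total_excess_less:
  assumes "finite S" "dec_smaller S y x" "\<forall>s\<in>S. y s \<in> \<int>"
  obtains a where "total_excess S a y < total_excess S a x"
proof -
  obtain j where j: "j < card S" and eq: "\<forall>i<j. dec_sorted S y ! i = dec_sorted S x ! i"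
    and less: "dec_sorted S y ! j < dec_sorted S x ! j"
    using assms(2) unfolding dec_smaller_def by blast
  have "dec_sorted S y ! j \<in> y ` S"
    using set_dec_sorted[OF assms(1), of y] j nth_mem[of j "dec_sorted S y"] by simp
  with assms(3) have "dec_sorted S y ! j \<in> \<int>"
    by auto
  then obtain a :: int where a: "dec_sorted S y ! j = of_int a"
    by (auto elim: Ints_cases)
  have "(\<Sum>i<card S. max 0 (dec_sorted S y ! i - of_int a))
      < (\<Sum>i<card S. max 0 (dec_sorted S x ! i - of_int a))"
  proof (rule sum_strict_mono_ex1)
    show "\<forall>i\<in>{..<card S}. max 0 (dec_sorted S y ! i - of_int a) \<le> max 0 (dec_sorted S x ! i - of_int a)"
    proof
      fix i assume "i \<in> {..<card S}"
      then have "i < card S" by simp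
      show "max 0 (dec_sorted S y ! i - of_int a) \<le> max 0 (dec_sorted S x ! i - of_int a)"
      proof (cases "i < j")
        case False
        then have "dec_sorted S y ! i \<le> of_int a"
          using dec_sorted_antimono[of j i S y] a \<open>i < card S\<close> by simp
        then show ?thesis by simp
      qed (simp add: eq)
    qed
    show "\<exists>i\<in>{..<card S}. max 0 (dec_sorted S y ! i - of_int a) < max 0 (dec_sorted S x ! i - of_int a)"
      using j a less by (intro bexI[of _ j]) auto
  qed simp
  then show thesis
    using that total_excess_dec_sorted by metis
qed

text \<open>A \<open>y\<close> preceding \<open>m\<close> in the decreasing order would have smaller
  excess for some \<open>a\<close>, so \<open>m\<close> would not be a minimizer for that
  \<open>a\<close>.\<close>

lemma total_excess_minimizer_imp_dec_min:
  assumes "finite S" "\<forall>y\<in>Q. \<forall>s\<in>S. y s \<in> \<int>" "m \<in> Q"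
    and min: "\<And>a. is_arg_min (total_excess S a) (\<lambda>x. x \<in> Q) m"
  shows "dec_min S Q m"
  unfolding dec_min_def
proof (intro conjI ballI)
  fix y assume y: "y \<in> Q"
  show "dec_le S m y"
  proof (rule ccontr)
    assume "\<not> dec_le S m y"
    then have "dec_smaller S y m"
      by (rule not_dec_le_imp_dec_smaller)
    then obtain a where "total_excess S a y < total_excess S a m"
      using dec_smaller_imp_total_excess_less assms(1,2) y by blast
    then show False
      using min[of a] y by (auto simp: is_arg_min_def)
  qed
qed fact

text \<open>By asymmetry, all dec-min elements share one sorted vector. Hence minimality for every
  \<open>a\<close>, once known for one of them, passes to all.\<close>

lemma dec_min_total_excess_unique:
  assumes "dec_min S Q m" "dec_min S Q m'"
  shows "total_excess S a m = total_excess S a m'"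
proof -
  have "dec_sorted S m = dec_sorted S m'"
    using assms dec_smaller_asym unfolding dec_min_def dec_le_def by metis
  then show ?thesis
    by (simp add: total_excess_dec_sorted)
qed

section \<open>Tight sets of supermodular functions\<close>

locale supermodular =
  fixes S :: "'a set" and p :: "'a set \<Rightarrow> ereal"
  assumes fin: "finite S"
    and valued: "int_or_minf_valued S p"
    and supermod: "supermodular_on S p"
    and p_empty: "p {} = 0"
begin

text \<open>Integer functions keep the descent arguments discrete. The base equation on
  \<open>S\<close> is left out and expressed as \<open>tight f S\<close>.\<close>

definition feasible :: "('a \<Rightarrow> int) \<Rightarrow> bool" where
  "feasible f \<longleftrightarrow> (\<forall>Z\<subseteq>S. p Z \<le> ereal (of_int (sum f Z)))"

definition tight :: "('a \<Rightarrow> int) \<Rightarrow> 'a set \<Rightarrow> bool" where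
  "tight f Z \<longleftrightarrow> Z \<subseteq> S \<and> p Z = ereal (of_int (sum f Z))"

lemma tight_empty: "tight f {}"
  by (simp add: tight_def p_empty)

text \<open>Uncrossing: supermodularity bounds the sum of the two \<open>p\<close>-values from below
  by the same total that feasibility gives as an upper bound.\<close>

lemma tight_Int_Un:
  assumes "feasible f" "tight f X" "tight f Y"
  shows "tight f (X \<inter> Y) \<and> tight f (X \<union> Y)"
proof -
  have sub: "X \<subseteq> S" "Y \<subseteq> S"
    and eq: "p X = ereal (of_int (sum f X))" "p Y = ereal (of_int (sum f Y))"
    using assms by (auto simp: tight_def)
  have "finite X" "finite Y"
    using sub fin finite_subset by auto
  then have sum: "sum f (X \<union> Y) + sum f (X \<inter> Y) = sum f X + sum f Y"
    by (simp add: sum.union_inter)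
  have "\<bar>p X\<bar> \<noteq> \<infinity>" "\<bar>p Y\<bar> \<noteq> \<infinity>"
    by (simp_all add: eq)
  then have "p X + p Y \<le> p (X \<inter> Y) + p (X \<union> Y)"
    using supermod[unfolded supermodular_on_def, rule_format, OF sub] by simp
  then have le: "ereal (of_int (sum f X + sum f Y)) \<le> p (X \<inter> Y) + p (X \<union> Y)"
    unfolding eq plus_ereal.simps of_int_add .
  have "X \<inter> Y \<subseteq> S" "X \<union> Y \<subseteq> S"
    using sub by auto
  then have "p (X \<inter> Y) \<le> ereal (of_int (sum f (X \<inter> Y)))" "p (X \<union> Y) \<le> ereal (of_int (sum f (X \<union> Y)))"
    using assms(1) unfolding feasible_def by blast+
  moreover have "real_of_int (sum f (X \<union> Y)) + of_int (sum f (X \<inter> Y)) = of_int (sum f X + sum f Y)"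
    unfolding sum[symmetric] by (rule of_int_add[symmetric])
  \<comment> \<open>Real upper bounds on both values and a real lower bound on their sum exclude
    infinite values.\<close>
  ultimately have "p (X \<inter> Y) = ereal (of_int (sum f (X \<inter> Y)))" "p (X \<union> Y) = ereal (of_int (sum f (X \<union> Y)))"
    using le by (cases "p (X \<inter> Y)"; cases "p (X \<union> Y)"; simp del: of_int_sum of_int_add)+
  then show ?thesis
    using \<open>X \<inter> Y \<subseteq> S\<close> \<open>X \<union> Y \<subseteq> S\<close> unfolding tight_def by blast
qed

lemma tight_UN:
  assumes "feasible f" "finite I" "\<And>i. i \<in> I \<Longrightarrow> tight f (Z i)"
  shows "tight f (\<Union>i\<in>I. Z i)"
  using assms(2,3)
  by (induction I rule: finite_induct) (simp_all add: tight_empty tight_Int_Un[OF assms(1)])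

text \<open>The factor \<open>S\<close> covers empty \<open>I\<close>, where the plain intersection
  would be \<open>UNIV\<close>.\<close>

lemma tight_INT:
  assumes "feasible f" "tight f S" "finite I" "\<And>i. i \<in> I \<Longrightarrow> tight f (Z i)"
  shows "tight f (S \<inter> (\<Inter>i\<in>I. Z i))"
  using assms(3,4)
proof (induction I rule: finite_induct)
  case (insert i I)
  then have "tight f (Z i \<inter> (S \<inter> (\<Inter>i\<in>I. Z i)))"
    using tight_Int_Un[OF assms(1)] by blast
  then show ?case
    by (simp add: Int_left_commute)
qed (use assms(2) in simp)

text \<open>Integrality of \<open>p\<close> enters here: a unit step can only violate constraints that were tight.\<close>

lemma tight_if_step_infeasible:
  assumes "feasible f" "\<not> feasible g" "\<And>Z. Z \<subseteq> S \<Longrightarrow> sum f Z \<le> sum g Z + 1"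
  obtains Z where "tight f Z" "sum g Z < sum f Z"
proof -
  obtain Z where Z: "Z \<subseteq> S" "\<not> p Z \<le> ereal (of_int (sum g Z))"
    using assms(2) by (auto simp: feasible_def)
  then have "p Z \<noteq> -\<infinity>"
    by auto
  then obtain k :: int where k: "p Z = ereal (of_int k)"
    using valued Z(1) unfolding int_or_minf_valued_def by blast
  have "p Z \<le> ereal (of_int (sum f Z))"
    using assms(1) Z(1) by (simp add: feasible_def)
  with k have "k \<le> sum f Z"
    by (simp del: of_int_sum)
  moreover have "sum g Z < k"
    using Z(2) k by (simp del: of_int_sum)
  moreover have "sum f Z \<le> sum g Z + 1"
    using assms(3) Z(1) by blast
  ultimately have "k = sum f Z" "sum g Z < sum f Z"
    by linarith+
  then show thesis
    using that Z(1) k by (simp add: tight_def)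
qed

end

section \<open>Integral base points\<close>

locale supermodular_base = supermodular +
  assumes finite_S_value: "\<bar>p S\<bar> \<noteq> \<infinity>"
begin

section \<open>Existence of integral base points\<close>

lemma ex_feasible: "\<exists>f. feasible f"
proof -
  obtain k where k: "\<forall>Z\<subseteq>S. p Z \<noteq> -\<infinity> \<longrightarrow> p Z = ereal (of_int (k Z))"
    using valued unfolding int_or_minf_valued_def by metis
  \<comment> \<open>The constant function \<open>M\<close> is feasible: a nonempty \<open>Z\<close>
    contains at least one copy of \<open>M\<close>, which is at least \<open>k Z\<close>.\<close>
  define M where "M = (\<Sum>Z\<in>Pow S. \<bar>k Z\<bar>)"
  have "p Z \<le> ereal (of_int (sum (\<lambda>_. M) Z))" if Z: "Z \<subseteq> S" for Z
  proof (cases "Z = {} \<or> p Z = -\<infinity>")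
    case False
    have "finite Z" using Z fin finite_subset by blast
    with False have "0 < card Z"
      by (simp add: card_gt_0_iff)
    then have "1 \<le> int (card Z)"
      by linarith
    moreover have "\<bar>k Z\<bar> \<le> M"
      unfolding M_def using Z fin by (intro member_le_sum) auto
    ultimately have "k Z \<le> int (card Z) * M"
      using mult_right_mono[of 1 "int (card Z)" M] by linarith
    then have "real_of_int (k Z) \<le> real_of_int (sum (\<lambda>_. M) Z)"
      unfolding of_int_le_iff by simp
    moreover have "p Z = ereal (of_int (k Z))"
      using k Z False by blast
    ultimately show ?thesis
      by (simp del: of_int_sum)
  qed (auto simp: p_empty)
  then show ?thesis
    unfolding feasible_def by blast
qed

text \<open>A feasible \<open>f\<close> with minimal \<open>sum f S\<close> has every \<open>s \<in> S\<close> in a tight set, and the union of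
  these tight sets is \<open>S\<close>.\<close>

lemma ex_feasible_tight: "\<exists>f. feasible f \<and> tight f S"
proof -
  have "p S \<noteq> -\<infinity>" using finite_S_value by auto
  then obtain k :: int where k: "p S = ereal (of_int k)"
    using valued unfolding int_or_minf_valued_def by blast
  have ge: "k \<le> sum f S" if "feasible f" for f
    using that k unfolding feasible_def by (metis ereal_less_eq(3) of_int_le_iff order_refl)
  \<comment> \<open>By \<open>ge\<close> the difference is nonnegative on feasible functions, so
    \<open>nat\<close> does not truncate.\<close>
  obtain f where f: "feasible f"
    and min: "\<And>g. feasible g \<Longrightarrow> nat (sum f S - k) \<le> nat (sum g S - k)"
    using ex_feasible ex_has_least_nat[of feasible _ "\<lambda>f. nat (sum f S - k)"] by blast
  have "\<exists>Z. tight f Z \<and> s \<in> Z" if s: "s \<in> S" for s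
  proof -
    \<comment> \<open>Lowering \<open>f\<close> at \<open>s\<close> contradicts minimality if
      feasible; the tight set that blocks it must contain \<open>s\<close>.\<close>
    define g where "g = (\<lambda>v. f v - (if v = s then 1 else 0))"
    have g: "sum g Z = sum f Z - (if s \<in> Z then 1 else 0)" if "Z \<subseteq> S" for Z
      using finite_subset[OF that fin] by (simp add: g_def sum_subtractf)
    have "\<not> feasible g"
      using min[of g] ge[of g] ge[OF f] g[of S] s by auto
    then obtain Z where "tight f Z" "sum g Z < sum f Z"
      by (rule tight_if_step_infeasible[OF f]) (use g in auto)
    then show ?thesis
      using g[of Z] by (auto simp: tight_def split: if_splits)
  qed
  then obtain Z where Z: "\<forall>s\<in>S. tight f (Z s) \<and> s \<in> Z s"
    by metis
  then have "tight f (\<Union>s\<in>S. Z s)"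
    using tight_UN[OF f fin] by blast
  moreover have "(\<Union>s\<in>S. Z s) = S"
    using Z by (auto simp: tight_def)
  ultimately show ?thesis
    using f by auto
qed

lemma integral_base_pointsI:
  assumes "feasible f" "tight f S"
  shows "(\<lambda>v\<in>S. real_of_int (f v)) \<in> integral_base_points S p"
proof -
  have "(\<Sum>v\<in>Z. (\<lambda>v\<in>S. real_of_int (f v)) v) = of_int (sum f Z)" if "Z \<subseteq> S" for Z
    using that by (auto intro!: sum.cong)
  then show ?thesis
    using assms unfolding integral_base_points_def base_polyhedron_def feasible_def tight_def
    by auto
qed

section \<open>Blocked unit transfers and uncrossing\<close>

lemma ex_excess_eq_if_no_transfer:
  assumes f: "feasible f" "tight f S"
    and opt: "\<And>s t. s \<in> S \<Longrightarrow> t \<in> S \<Longrightarrow> f s + 2 \<le> f t \<Longrightarrow>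
      \<not> feasible (\<lambda>v. f v + (if v = s then 1 else 0) - (if v = t then 1 else 0))"
  shows "\<exists>X\<subseteq>S. p X = ereal (of_int (sum f X)) \<and> (\<Sum>v\<in>S. max 0 (f v - a)) = sum f X - a * int (card X)"
proof -
  define T where "T = {t\<in>S. a < f t}"
  define L where "L = {s\<in>S. f s < a}"
  have finTL: "finite T" "finite L"
    using fin by (auto simp: T_def L_def)
  have "\<exists>Z. tight f Z \<and> t \<in> Z \<and> s \<notin> Z" if t: "t \<in> T" and s: "s \<in> L" for t s
  proof -
    let ?g = "\<lambda>v. f v + (if v = s then 1 else 0) - (if v = t then 1 else 0)"
    have g: "sum ?g Z = sum f Z + (if s \<in> Z then 1 else 0) - (if t \<in> Z then 1 else 0)"
      if "Z \<subseteq> S" for Z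
      using finite_subset[OF that fin] by (simp add: sum_subtractf sum.distrib)
    \<comment> \<open>For integers, \<open>f s < a < f t\<close> gives the gap of 2 that
      \<open>opt\<close> requires.\<close>
    have "\<not> feasible ?g"
      using s t by (intro opt) (auto simp: T_def L_def)
    then obtain Z where "tight f Z" "sum ?g Z < sum f Z"
      by (rule tight_if_step_infeasible[OF f(1)]) (use g in auto)
    then show ?thesis
      using g[of Z] by (auto simp: tight_def split: if_splits)
  qed
  then obtain Z where Z: "\<And>t s. t \<in> T \<Longrightarrow> s \<in> L \<Longrightarrow> tight f (Z t s) \<and> t \<in> Z t s \<and> s \<notin> Z t s"
    by metis
  \<comment> \<open>For fixed \<open>t\<close> the intersection keeps \<open>t\<close> and avoids
    all of \<open>L\<close>; the union over \<open>t\<close> then covers \<open>T\<close>.\<close>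
  define X where "X = (\<Union>t\<in>T. S \<inter> (\<Inter>s\<in>L. Z t s))"
  have X: "tight f X"
    unfolding X_def using Z finTL f by (intro tight_UN tight_INT) auto
  have "T \<subseteq> X" "X \<inter> L = {}" "X \<subseteq> S"
    using Z by (auto simp: X_def T_def)
  then have "(\<Sum>v\<in>S. max 0 (f v - a)) = (\<Sum>v\<in>X. max 0 (f v - a))"
    using fin by (intro sum.mono_neutral_right) (auto simp: T_def)
  also have "\<dots> = (\<Sum>v\<in>X. f v - a)"
    using \<open>X \<inter> L = {}\<close> \<open>X \<subseteq> S\<close> by (intro sum.cong) (auto simp: L_def max_def)
  also have "\<dots> = sum f X - a * int (card X)"
    by (simp add: sum_subtractf)
  finally show ?thesis
    using X by (auto simp: tight_def)
qed

text \<open>Take \<open>f\<close> with least sum of squares: a unit transfer from \<open>t\<close>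
  to \<open>s\<close> changes that sum by \<open>2 * (f s - f t) + 2\<close>, which is at most
  -2.\<close>

lemma ex_no_transfer:
  "\<exists>f. feasible f \<and> tight f S \<and> (\<forall>s\<in>S. \<forall>t\<in>S. f s + 2 \<le> f t \<longrightarrow>
      \<not> feasible (\<lambda>v. f v + (if v = s then 1 else 0) - (if v = t then 1 else 0)))"
proof -
  let ?sq = "\<lambda>f. nat (\<Sum>v\<in>S. (f v)\<^sup>2)"
  obtain f where f: "feasible f" "tight f S"
    and min: "\<And>g. feasible g \<Longrightarrow> tight g S \<Longrightarrow> ?sq f \<le> ?sq g"
    using ex_feasible_tight ex_has_least_nat[of "\<lambda>f. feasible f \<and> tight f S" _ ?sq] by metis
  have "\<not> feasible (\<lambda>v. f v + (if v = s then 1 else 0) - (if v = t then 1 else 0))"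
    (is "\<not> feasible ?g") if st: "s \<in> S" "t \<in> S" "f s + 2 \<le> f t" for s t
  proof
    assume g: "feasible ?g"
    have "sum ?g S = sum f S"
      using fin st by (simp add: sum_subtractf sum.distrib)
    then have "tight ?g S"
      using f(2) unfolding tight_def by simp
    then have "?sq f \<le> ?sq ?g"
      using min g by blast
    moreover have "0 \<le> (\<Sum>v\<in>S. (f v)\<^sup>2)" "0 \<le> (\<Sum>v\<in>S. (?g v)\<^sup>2)"
      by (intro sum_nonneg; simp)+
    ultimately have le: "(\<Sum>v\<in>S. (f v)\<^sup>2) \<le> (\<Sum>v\<in>S. (?g v)\<^sup>2)"
      by linarith
    have "(\<Sum>v\<in>S. (?g v)\<^sup>2)
        = (\<Sum>v\<in>S. (f v)\<^sup>2 + (if v = s then 2 * f s + 1 else 0) + (if v = t then 1 - 2 * f t else 0))"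
      using st by (intro sum.cong) (auto simp: power2_eq_square algebra_simps)
    also have "\<dots> = (\<Sum>v\<in>S. (f v)\<^sup>2) + (2 * f s + 1) + (1 - 2 * f t)"
      using fin st by (simp add: sum.distrib)
    finally show False
      using le st(3) by linarith
  qed
  with f show ?thesis
    by blast
qed

section \<open>Min-max duality\<close>

lemma total_excess_weak_duality:
  assumes "x \<in> base_polyhedron S p" "X \<subseteq> S"
  shows "p X - ereal (of_int a * real (card X)) \<le> ereal (total_excess S a x)"
proof -
  have "p X \<le> ereal (sum x X)"
    \<comment> \<open>The inequalities cover only proper subsets; for \<open>S\<close> the defining
      equation is used.\<close>
    using assms by (cases "X = S") (auto simp: base_polyhedron_def)
  then have "p X - ereal (of_int a * real (card X)) \<le> ereal (sum x X) - ereal (of_int a * real (card X))"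
    by (rule ereal_minus_mono) simp
  also have "\<dots> = ereal (\<Sum>v\<in>X. x v - of_int a)"
    by (simp add: sum_subtractf mult.commute)
  also have "(\<Sum>v\<in>X. x v - of_int a) \<le> (\<Sum>v\<in>X. max 0 (x v - of_int a))"
    by (intro sum_mono) simp
  also have "\<dots> \<le> total_excess S a x"
    unfolding total_excess_def using fin assms(2) by (intro sum_mono2) auto
  finally show ?thesis
    by simp
qed

text \<open>The point \<open>m\<close> is fixed before \<open>a\<close>: the no-transfer property
  does not mention \<open>a\<close>, and only the tight set \<open>X\<close> varies with it.\<close>

lemma ex_total_excess_strong_duality:
  "\<exists>m\<in>integral_base_points S p. \<forall>a. \<exists>X\<subseteq>S.
     ereal (total_excess S a m) = p X - ereal (of_int a * real (card X))"
proof -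
  obtain f where f: "feasible f" "tight f S" and opt: "\<And>s t. s \<in> S \<Longrightarrow> t \<in> S \<Longrightarrow> f s + 2 \<le> f t \<Longrightarrow>
      \<not> feasible (\<lambda>v. f v + (if v = s then 1 else 0) - (if v = t then 1 else 0))"
    using ex_no_transfer by blast
  let ?m = "\<lambda>v\<in>S. real_of_int (f v)"
  have "\<exists>X\<subseteq>S. ereal (total_excess S a ?m) = p X - ereal (of_int a * real (card X))" for a
  proof -
    obtain X where X: "X \<subseteq> S" "p X = ereal (of_int (sum f X))"
      and eq: "(\<Sum>v\<in>S. max 0 (f v - a)) = sum f X - a * int (card X)"
      using ex_excess_eq_if_no_transfer[OF f opt] by blast
    have "total_excess S a ?m = of_int (\<Sum>v\<in>S. max 0 (f v - a))"
      by (simp add: total_excess_def of_int_max)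
    then have "total_excess S a ?m = of_int (sum f X) - of_int a * real (card X)"
      unfolding eq by simp
    then show ?thesis
      using X by (intro exI[of _ X]) simp
  qed
  then show ?thesis
    using integral_base_pointsI[OF f] by blast
qed

end

theorem theorem4p13:
  fixes S :: "'a set" and p :: "'a set \<Rightarrow> ereal"
  assumes "finite S" and "S \<noteq> {}"
    and "int_or_minf_valued S p"
    and "supermodular_on S p"
    and "p {} = 0" and "\<bar>p S\<bar> \<noteq> \<infinity>"
  shows "(\<forall>a::int. \<exists>m. is_arg_min (total_excess S a) (\<lambda>x. x \<in> integral_base_points S p) m \<and>
             ereal (total_excess S a m) =
               (MAX X\<in>Pow S. p X - ereal (of_int a * real (card X)))) \<and>
         (\<forall>m \<in> integral_base_points S p.
             dec_min S (integral_base_points S p) m \<longleftrightarrow>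
             (\<forall>a::int. is_arg_min (total_excess S a) (\<lambda>x. x \<in> integral_base_points S p) m))"
proof -
  interpret supermodular_base S p
    by unfold_locales (use assms in auto)
  let ?B = "integral_base_points S p"
  have weak: "p X - ereal (of_int a * real (card X)) \<le> ereal (total_excess S a x)"
    if "x \<in> ?B" "X \<subseteq> S" for x X a
    using that total_excess_weak_duality by (auto simp: integral_base_points_def)
  obtain m where m: "m \<in> ?B"
    and strong: "\<And>a. \<exists>X\<subseteq>S. ereal (total_excess S a m) = p X - ereal (of_int a * real (card X))"
    using ex_total_excess_strong_duality by blast
  have le: "total_excess S a m \<le> total_excess S a y" if "y \<in> ?B" for a y
    using strong[of a] weak[OF that] by (metis ereal_less_eq(3))
  have min: "is_arg_min (total_excess S a) (\<lambda>x. x \<in> ?B) m" for a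
    using le m by (auto simp: is_arg_min_def not_less)
  have max: "ereal (total_excess S a m) = (MAX X\<in>Pow S. p X - ereal (of_int a * real (card X)))" for a
    by (rule Max_eqI[symmetric]) (use fin weak[OF m] strong[of a] in auto)
  have int: "\<forall>y\<in>?B. \<forall>s\<in>S. y s \<in> \<int>"
    by (simp add: integral_base_points_def)
  note minimizer_imp_dec_min = total_excess_minimizer_imp_dec_min[OF fin int]
  \<comment> \<open>The simultaneous minimizer \<open>m\<close> is itself dec-min, so
    \<open>m'\<close> has the same excess as \<open>m\<close> for every \<open>a\<close>.\<close>
  have "is_arg_min (total_excess S a) (\<lambda>x. x \<in> ?B) m'" if "m' \<in> ?B" "dec_min S ?B m'" for m' a
    using dec_min_total_excess_unique[OF that(2) minimizer_imp_dec_min[OF m min]] le that(1)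
    by (auto simp: is_arg_min_def not_less)
  with min max minimizer_imp_dec_min show ?thesis
    by blast
qed

end
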